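(* Let $G=(V,E)$, $OD$, $(\kappa_{ij})$, $(\phi_{ij})$ be the data of an AMoD instance with $R>0$ whose AMoD problem is feasible. For $L>0$ let $G'=(V',E')$, $OD'$ and the cost function $F_{E'}$ (which depends on $L$) be the associated extended instance, let $\bar E=E'\setminus E$ be the set of dummy edges, and let $\boldsymbol{\kappa}=\{\kappa_{in} : (i,n)\in\bar E\}$. Let $\boldsymbol{x}^*$ denote a minimizer of $F_{E'}(\boldsymbol{x})$ over all assignments $\boldsymbol{x}$ that are feasible for $(G',OD')$. Then for every $\delta\in(0,1]$ there exists $L_\delta\in(0,\infty)$ such that if $L>L_\delta$ then $$\frac{\|\boldsymbol{x}^*_{\bar E}-\boldsymbol{\kappa}\|_1}{2R}\le\delta .$$
   Context: Network and demand. $G=(V,E)$ is a finite directed graph; each edge $(i,j)\in E$ has a capacity $\kappa_{ij}>0$ and a free-flow travel time $\phi_{ij}>0$. The cost (travel time) of an edge with flow $x_{ij}\ge 0$ is the BPR function $$c_{ij}(x_{ij})=\phi_{ij}\left(1+\alpha\left(\frac{x_{ij}}{\kappa_{ij}}\right)^{\beta}\right),\qquad \alpha=0.15,\ \beta=4 .$$ Travel demand is a finite set of requests $OD=\{(\lambda_m,o_m,d_m)\}_{m=1}^M$ with intensity $\lambda_m>0$, origin $o_m\in V$ and destination $d_m\in V$. Feasible assignments. For a directed graph with edge set $\mathcal E$ and a request set, a feasible assignment consists of flows $x_{ijm}\ge 0$ (one for each edge $(i,j)\in\mathcal E$ and each request $m$) such that for every vertex $i$ and every request $m$ $$\sum_{j:(i,j)\in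 \mathcal E}x_{ijm}-\sum_{j:(j,i)\in \mathcal E}x_{jim}=\lambda_{im},$$ where $\lambda_{im}=\lambda_m$ if $o_m=i$, $\lambda_{im}=-\lambda_m$ if $d_m=i$, and $\lambda_{im}=0$ otherwise. The assignment is represented by its total edge flows $\boldsymbol{x}=\{x_{ij}=\sum_m x_{ijm}\}_{(i,j)\in\mathcal E}$. For a set of edges $A$, $F_A(\boldsymbol{x})=\sum_{(i,j)\in A}x_{ij}c_{ij}(x_{ij})$, and $\boldsymbol{x}_A$ is the restriction of $\boldsymbol{x}$ to $A$. Rebalancing. For $i\in V$ let $r_i=\sum_{m=1}^M(\mathbf 1\{d_m=i\}-\mathbf 1\{o_m=i\})\lambda_m$, and let $R=\sum_{i\in V}\mathbf 1\{r_i>0\}\,r_i$. The AMoD problem on $(G,OD)$ is to minimize $F_E(\hat{\boldsymbol{x}})$, $\hat x_{ij}=x_{ij}+x_{ijr}$, where $\boldsymbol{x}$ is a feasible assignment for $(G,OD)$ and the rebalancing flows $x_{ijr}\ge 0$ satisfy $\sum_{j:(i,j)\in E}x_{ijr}-\sum_{j:(j,i)\in E}x_{jir}=r_i$ for all $i\in V$. It is feasible if such flows exist. Extended instance. Let $n\notin V$ be a new (dummy) vertex, $V'=V\cup\{n\}$, $E'=E\cup\{(i,n) : i\in V,\ r_i<0\}$, $G'=(V',E')$. Each dummy edge $(i,n)\in\bar E=E'\setminus E$ has the BPR cost with capacity $\kappa_{in}=-r_i$ and free-flow time $\phi_{in}=L$, i.e. $c_{in}(x)=L(1+0.15(x/\kappa_{in})^4)$,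 where $L>0$ is a constant. The extended request set $OD'$ consists of $OD$ together with the request $(r_i,i,n)$ for every $i\in V$ with $r_i>0$. The cost is $F_{E'}(\boldsymbol{x})=F_E(\boldsymbol{x})+F_{\bar E}(\boldsymbol{x})$. *)

theory Defs
  imports Complex_Main "Graph_Theory.Pair_Digraph"
begin

record ('m, 'v) requests =
  req_index :: "'m set"
  intensity :: "'m \<Rightarrow> real"
  origin :: "'m \<Rightarrow> 'v"
  destination :: "'m \<Rightarrow> 'v"

definition valid_requests :: "'v set \<Rightarrow> ('m, 'v) requests \<Rightarrow> bool" where
  "valid_requests V OD \<longleftrightarrow> finite (req_index OD) \<and>
     (\<forall>m\<in>req_index OD. intensity OD m > 0 \<and> origin OD m \<in> V \<and> destination OD m \<in> V)"

definition bpr_cost :: "real \<Rightarrow> real \<Rightarrow> real \<Rightarrow> real" where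
  "bpr_cost \<phi> \<kappa> x = \<phi> * (1 + 0.15 * (x / \<kappa>) ^ 4)"

definition total_cost ::
  "('v \<times> 'v \<Rightarrow> real) \<Rightarrow> ('v \<times> 'v \<Rightarrow> real) \<Rightarrow> ('v \<times> 'v) set \<Rightarrow> ('v \<times> 'v \<Rightarrow> real) \<Rightarrow> real" where
  "total_cost \<phi> \<kappa> A x = (\<Sum>e\<in>A. x e * bpr_cost (\<phi> e) (\<kappa> e) (x e))"

definition net_outflow :: "'v pair_pre_digraph \<Rightarrow> ('v \<times> 'v \<Rightarrow> real) \<Rightarrow> 'v \<Rightarrow> real" where
  "net_outflow G x i =
     (\<Sum>j | (i, j) \<in> parcs G. x (i, j)) - (\<Sum>j | (j, i) \<in> parcs G. x (j, i))"

text \<open>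
  The cases are tried in order. A request whose origin and destination coincide can therefore
  not be served by any flow, because its balances do not sum to zero over the vertices.
\<close>

definition balance :: "('m, 'v) requests \<Rightarrow> 'v \<Rightarrow> 'm \<Rightarrow> real" where
  "balance OD i m =
     (if origin OD m = i then intensity OD m
      else if destination OD m = i then - intensity OD m
      else 0)"

text \<open>
  An assignment is represented by its total edge flows; the flows of the individual requests are
  the witness \<open>y\<close>. Values of flows outside the edge set are unconstrained and irrelevant.
\<close>

definition feasible_assignment ::
  "'v pair_pre_digraph \<Rightarrow> ('m, 'v) requests \<Rightarrow> ('v \<times> 'v \<Rightarrow> real) \<Rightarrow> bool" where
  "feasible_assignment G OD x \<longleftrightarrow>
     (\<exists>y :: 'm \<Rightarrow> 'v \<times> 'v \<Rightarrow> real.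
        (\<forall>m\<in>req_index OD. \<forall>e\<in>parcs G. y m e \<ge> 0) \<and>
        (\<forall>m\<in>req_index OD. \<forall>i\<in>pverts G. net_outflow G (y m) i = balance OD i m) \<and>
        (\<forall>e\<in>parcs G. x e = (\<Sum>m\<in>req_index OD. y m e)))"

definition imbalance :: "('m, 'v) requests \<Rightarrow> 'v \<Rightarrow> real" where
  "imbalance OD i =
     (\<Sum>m\<in>req_index OD.
        (of_bool (destination OD m = i) - of_bool (origin OD m = i)) * intensity OD m)"

definition total_rebalancing :: "'v pair_pre_digraph \<Rightarrow> ('m, 'v) requests \<Rightarrow> real" where
  "total_rebalancing G OD = (\<Sum>i\<in>pverts G. of_bool (imbalance OD i > 0) * imbalance OD i)"

definition feasible_rebalancing ::
  "'v pair_pre_digraph \<Rightarrow> ('m, 'v) requests \<Rightarrow> ('v \<times> 'v \<Rightarrow> real) \<Rightarrow> bool" where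
  "feasible_rebalancing G OD x \<longleftrightarrow>
     (\<forall>e\<in>parcs G. x e \<ge> 0) \<and> (\<forall>i\<in>pverts G. net_outflow G x i = imbalance OD i)"

definition amod_feasible :: "'v pair_pre_digraph \<Rightarrow> ('m, 'v) requests \<Rightarrow> bool" where
  "amod_feasible G OD \<longleftrightarrow>
     (\<exists>x. feasible_assignment G OD x) \<and> (\<exists>x. feasible_rebalancing G OD x)"

definition ext_graph ::
  "'v pair_pre_digraph \<Rightarrow> ('m, 'v) requests \<Rightarrow> 'v \<Rightarrow> 'v pair_pre_digraph" where
  "ext_graph G OD n =
     \<lparr> pverts = insert n (pverts G),
       parcs = parcs G \<union> {(i, n) | i. i \<in> pverts G \<and> imbalance OD i < 0} \<rparr>"

definition dummy_edges ::
  "'v pair_pre_digraph \<Rightarrow> ('m, 'v) requests \<Rightarrow> 'v \<Rightarrow> ('v \<times> 'v) set" where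
  "dummy_edges G OD n = parcs (ext_graph G OD n) - parcs G"

definition ext_capacity ::
  "'v pair_pre_digraph \<Rightarrow> ('m, 'v) requests \<Rightarrow> ('v \<times> 'v \<Rightarrow> real) \<Rightarrow> 'v \<times> 'v \<Rightarrow> real" where
  "ext_capacity G OD \<kappa> e = (if e \<in> parcs G then \<kappa> e else - imbalance OD (fst e))"

definition ext_time ::
  "'v pair_pre_digraph \<Rightarrow> real \<Rightarrow> ('v \<times> 'v \<Rightarrow> real) \<Rightarrow> 'v \<times> 'v \<Rightarrow> real" where
  "ext_time G L \<phi> e = (if e \<in> parcs G then \<phi> e else L)"

text \<open>Original requests are tagged \<open>Inl\<close>; \<open>Inr i\<close> is the request from \<open>i\<close> to the dummy vertex.\<close>

definition ext_requests ::
  "'v pair_pre_digraph \<Rightarrow> ('m, 'v) requests \<Rightarrow> 'v \<Rightarrow> ('m + 'v, 'v) requests" where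
  "ext_requests G OD n =
     \<lparr> req_index = req_index OD <+> {i \<in> pverts G. imbalance OD i > 0},
       intensity = case_sum (intensity OD) (imbalance OD),
       origin = case_sum (origin OD) (\<lambda>i. i),
       destination = case_sum (destination OD) (\<lambda>_. n) \<rparr>"

end

theory Submission
  imports Defs
begin

text \<open>
  Both the dummy capacities and, for every feasible extended assignment, the dummy flows sum to
  \<open>R\<close>.  Splitting a rebalancing flow by its sources gives a feasible extended assignment that
  respects the dummy capacities, so the optimal cost is at most \<open>C + 1.15 * L * R\<close> with \<open>C\<close>
  independent of \<open>L\<close>.  On the other hand, by convexity of \<open>x * c(x)\<close>, the dummy edges alone cost
  at least \<open>1.15 * L * R\<close> plus \<open>L\<close> times a quadratic penalty in the deviation from the
  capacities.  The penalty is therefore at most \<open>C / L\<close>.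
\<close>

section \<open>Net outflow: linearity and summation over vertex sets\<close>

lemma finite_arcs_from_to:
  assumes "pair_fin_digraph D"
  shows "finite {j. (i, j) \<in> parcs D}" "finite {j. (j, i) \<in> parcs D}"
proof -
  interpret pair_fin_digraph D by fact
  have "{j. (i, j) \<in> parcs D} \<subseteq> snd ` parcs D" "{j. (j, i) \<in> parcs D} \<subseteq> fst ` parcs D"
    by force+
  then show "finite {j. (i, j) \<in> parcs D}" "finite {j. (j, i) \<in> parcs D}"
    using pair_finite_arcs by (auto intro: finite_subset)
qed

lemma net_outflow_add:
  "net_outflow D (\<lambda>e. x e + y e) i = net_outflow D x i + net_outflow D y i"
  by (simp add: net_outflow_def sum.distrib)

lemma net_outflow_scale:
  "net_outflow D (\<lambda>e. c * x e) i = c * net_outflow D x i"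
  by (simp add: net_outflow_def sum_distrib_left right_diff_distrib)

lemma net_outflow_zero: "net_outflow D (\<lambda>e. 0) i = 0"
  by (simp add: net_outflow_def)

lemma net_outflow_single_arc:
  assumes "pair_fin_digraph D" "(u, v) \<in> parcs D"
  shows "net_outflow D (\<lambda>e. of_bool (e = (u, v))) i = of_bool (i = u) - of_bool (i = v)"
proof -
  have "(\<Sum>j | (i, j) \<in> parcs D. of_bool ((i, j) = (u, v))) = (of_bool (i = u) :: real)"
    using finite_arcs_from_to(1)[OF assms(1), of i] assms(2)
    by (cases "i = u") (auto simp: of_bool_def sum.delta)
  moreover have "(\<Sum>j | (j, i) \<in> parcs D. of_bool ((j, i) = (u, v))) = (of_bool (i = v) :: real)"
    using finite_arcs_from_to(2)[OF assms(1), of i] assms(2)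
    by (cases "i = v") (auto simp: of_bool_def sum.delta)
  ultimately show ?thesis
    by (simp add: net_outflow_def)
qed

text \<open>An arc counts positively at its tail and negatively at its head, so the vertex sum can
  be regrouped by arcs. This supplies the cut argument in \<open>sink_reachable\<close>.\<close>

lemma sum_net_outflow:
  assumes "pair_fin_digraph D" "finite S"
  shows "(\<Sum>i\<in>S. net_outflow D x i) =
    (\<Sum>e | e \<in> parcs D \<and> fst e \<in> S. x e) - (\<Sum>e | e \<in> parcs D \<and> snd e \<in> S. x e)"
proof -
  note fin = finite_arcs_from_to[OF assms(1)]
  have "(\<Sum>i\<in>S. \<Sum>j | (i, j) \<in> parcs D. x (i, j)) =
      (\<Sum>e\<in>Sigma S (\<lambda>i. {j. (i, j) \<in> parcs D}). x e)"
    using assms(2) fin by (subst sum.Sigma) (auto simp: split_def)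
  also have "Sigma S (\<lambda>i. {j. (i, j) \<in> parcs D}) = {e \<in> parcs D. fst e \<in> S}"
    by force
  finally have out: "(\<Sum>i\<in>S. \<Sum>j | (i, j) \<in> parcs D. x (i, j)) =
      (\<Sum>e | e \<in> parcs D \<and> fst e \<in> S. x e)" .
  \<comment> \<open>The index pairs are (head, tail) here, so they must be swapped to become
    arcs.\<close>
  have "(\<Sum>i\<in>S. \<Sum>j | (j, i) \<in> parcs D. x (j, i)) =
      (\<Sum>e\<in>Sigma S (\<lambda>i. {j. (j, i) \<in> parcs D}). x (prod.swap e))"
    using assms(2) fin by (subst sum.Sigma) (auto simp: split_def prod.swap_def)
  also have "\<dots> = (\<Sum>e\<in>prod.swap ` Sigma S (\<lambda>i. {j. (j, i) \<in> parcs D}). x e)"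
    by (subst sum.reindex) (auto intro: inj_onI)
  also have "prod.swap ` Sigma S (\<lambda>i. {j. (j, i) \<in> parcs D}) = {e \<in> parcs D. snd e \<in> S}"
    by force
  finally show ?thesis
    using out by (simp add: net_outflow_def sum_subtractf)
qed

section \<open>Splitting a flow by its sources\<close>

text \<open>Otherwise the vertices reachable from \<open>s\<close> along positive arcs would form a
  set avoiding \<open>n\<close> that no positive flow leaves, although its total net outflow is
  positive.\<close>

lemma sink_reachable:
  assumes "pair_fin_digraph D" and z: "\<forall>e\<in>parcs D. z e \<ge> (0::real)"
    and b: "\<forall>i\<in>pverts D - {n}. net_outflow D z i \<ge> 0"
    and s: "s \<in> pverts D" "net_outflow D z s > 0"
  shows "(s, n) \<in> {e \<in> parcs D. z e > 0}\<^sup>*"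
proof (rule ccontr)
  interpret pair_fin_digraph D by fact
  let ?P = "{e \<in> parcs D. z e > 0}"
  assume notin: "(s, n) \<notin> ?P\<^sup>*"
  define S where "S = {v \<in> pverts D. (s, v) \<in> ?P\<^sup>*}"
  have fS: "finite S" by (simp add: S_def)
  have sS: "s \<in> S" using s by (simp add: S_def)
  have "0 < net_outflow D z s" by fact
  \<comment> \<open>Since \<open>n\<close> lies outside \<open>S\<close>, every other summand is
    nonnegative.\<close>
  also have "\<dots> \<le> (\<Sum>i\<in>S. net_outflow D z i)"
    using sS fS b notin by (intro member_le_sum) (auto simp: S_def)
  also have "\<dots> = (\<Sum>e | e \<in> parcs D \<and> fst e \<in> S. z e) - (\<Sum>e | e \<in> parcs D \<and> snd e \<in> S. z e)"
    by (rule sum_net_outflow[OF assms(1) fS])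
  finally have lt: "(\<Sum>e | e \<in> parcs D \<and> snd e \<in> S. z e) < (\<Sum>e | e \<in> parcs D \<and> fst e \<in> S. z e)"
    by simp
  have closed: "snd e \<in> S" if "e \<in> parcs D" "fst e \<in> S" "z e > 0" for e
  proof -
    have "(s, fst e) \<in> ?P\<^sup>*" using that by (simp add: S_def)
    moreover have "(fst e, snd e) \<in> ?P" using that by simp
    ultimately have "(s, snd e) \<in> ?P\<^sup>*" by (rule rtrancl_into_rtrancl)
    then show ?thesis using that in_arcsD2[of "fst e" "snd e"] by (simp add: S_def)
  qed
  have "(\<Sum>e | e \<in> parcs D \<and> fst e \<in> S. z e) = (\<Sum>e | e \<in> parcs D \<and> fst e \<in> S \<and> z e > 0. z e)"
    using z by (intro sum.mono_neutral_right) force+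
  also have "\<dots> \<le> (\<Sum>e | e \<in> parcs D \<and> snd e \<in> S. z e)"
    using z closed by (intro sum_mono2) auto
  finally show False using lt by simp
qed

text \<open>Induction along the walk, adding the indicator of each new arc; the inner terms
  telescope. A repeated arc just accumulates weight, so only the support is controlled.\<close>

lemma unit_flow_along_walk:
  assumes "pair_fin_digraph D" "P \<subseteq> parcs D" "(s, t) \<in> P\<^sup>*"
  shows "\<exists>f. (\<forall>e. f e \<ge> (0::real)) \<and> (\<forall>e. f e > 0 \<longrightarrow> e \<in> P) \<and>
    (\<forall>i. net_outflow D f i = of_bool (i = s) - of_bool (i = t))"
  using assms(3)
proof (induction rule: rtrancl_induct)
  case base
  show ?case by (rule exI[of _ "\<lambda>e. 0"]) (simp add: net_outflow_zero)
next
  case (step u v)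
  then obtain f where f: "\<forall>e. f e \<ge> (0::real)" "\<forall>e. f e > 0 \<longrightarrow> e \<in> P"
    "\<forall>i. net_outflow D f i = of_bool (i = s) - of_bool (i = u)" by blast
  have "(u, v) \<in> parcs D" using step assms(2) by blast
  from net_outflow_single_arc[OF assms(1) this]
  have "net_outflow D (\<lambda>e. f e + of_bool (e = (u, v))) i = of_bool (i = s) - of_bool (i = v)" for i
    using f(3) by (simp add: net_outflow_add)
  moreover have "f e + of_bool (e = (u, v)) > 0 \<longrightarrow> e \<in> P" for e
    using f(2) step(2) by (cases "e = (u, v)") (auto simp del: split_paired_All)
  ultimately show ?case
    using f(1) by (intro exI[of _ "\<lambda>e. f e + of_bool (e = (u, v))"]) simp
qed

text \<open>
  Push as much flow as possible along a walk of positive arcs from a source to the sink: this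
  either empties an arc or exhausts the source, which is the induction measure.
\<close>

lemma flow_split_by_source:
  assumes "pair_fin_digraph D" and n: "n \<in> pverts D"
    and "\<forall>e\<in>parcs D. z e \<ge> (0::real)"
    and "\<forall>i\<in>pverts D - {n}. net_outflow D z i \<ge> 0"
  shows "\<exists>y. (\<forall>s. \<forall>e\<in>parcs D. y s e \<ge> 0) \<and>
    (\<forall>s\<in>pverts D - {n}. \<forall>i\<in>pverts D.
       net_outflow D (y s) i = net_outflow D z s * (of_bool (i = s) - of_bool (i = n))) \<and>
    (\<forall>e\<in>parcs D. (\<Sum>s\<in>pverts D - {n}. y s e) \<le> z e)"
  using assms(3,4)
proof (induction "card {e \<in> parcs D. z e > 0} + card {s \<in> pverts D - {n}. net_outflow D z s > 0}"
    arbitrary: z rule: less_induct)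
  case (less z)
  interpret pair_fin_digraph D by fact
  show ?case
  proof (cases "\<exists>s\<in>pverts D - {n}. net_outflow D z s > 0")
    case False
    then have "net_outflow D z s = 0" if "s \<in> pverts D - {n}" for s
      using less.prems(2) that by force
    \<comment> \<open>Without sources the zero flows suffice. Circulations may remain in
      \<open>z\<close>; this is why the pieces need only sum to at most \<open>z\<close>.\<close>
    then show ?thesis
      using less.prems(1) by (intro exI[of _ "\<lambda>s e. 0"]) (simp add: net_outflow_zero)
  next
    case True
    then obtain s where s: "s \<in> pverts D" "s \<noteq> n" "net_outflow D z s > 0" by blast
    let ?P = "{e \<in> parcs D. z e > 0}"
    have "(s, n) \<in> ?P\<^sup>*"
      using sink_reachable[OF assms(1) less.prems s(1,3)] .
    then obtain f where f: "\<And>e. f e \<ge> (0::real)" "\<And>e. f e > 0 \<Longrightarrow> e \<in> ?P"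
      "\<And>i. net_outflow D f i = of_bool (i = s) - of_bool (i = n)"
      using unit_flow_along_walk[OF assms(1), of ?P s n] by blast
    \<comment> \<open>The minimum of \<open>Q\<close> is the largest multiple of \<open>f\<close>
      that can be subtracted while keeping \<open>z\<close> nonnegative on the arcs and the supply
      of \<open>s\<close> nonnegative.\<close>
    define Q where "Q = insert (net_outflow D z s) ((\<lambda>e. z e / f e) ` {e \<in> parcs D. f e > 0})"
    define \<epsilon> where "\<epsilon> = Min Q"
    have Q: "finite Q" "Q \<noteq> {}" by (simp_all add: Q_def)
    have eps: "\<epsilon> \<in> Q" using Min_in[OF Q] by (simp add: \<epsilon>_def)
    have eps_pos: "\<epsilon> > 0"
      using eps s(3) f(2) by (auto simp: Q_def)
    have eps_s: "\<epsilon> \<le> net_outflow D z s"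
      using Min_le[OF Q(1)] by (simp add: \<epsilon>_def Q_def)
    have eps_f: "\<epsilon> * f e \<le> z e" if "e \<in> parcs D" for e
    proof (cases "f e > 0")
      case True
      then have "\<epsilon> \<le> z e / f e"
        using Min_le[OF Q(1)] that by (auto simp: \<epsilon>_def Q_def)
      then show ?thesis using True by (simp add: field_simps)
    next
      case False
      then have "f e = 0" using f(1)[of e] by simp
      then show ?thesis using less.prems(1) that by simp
    qed
    define z' where "z' = (\<lambda>e. z e + (- \<epsilon>) * f e)"
    have net: "net_outflow D z' i = net_outflow D z i - \<epsilon> * (of_bool (i = s) - of_bool (i = n))" for i
      unfolding z'_def net_outflow_add net_outflow_scale f(3) by simp
    have z'0: "\<forall>e\<in>parcs D. z' e \<ge> 0" using eps_f by (simp add: z'_def)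
    have b': "\<forall>i\<in>pverts D - {n}. net_outflow D z' i \<ge> 0"
      using less.prems(2) eps_s by (auto simp: net)
    have z'le: "z' e \<le> z e" for e using eps_pos f(1)[of e] by (simp add: z'_def)
    let ?P' = "{e \<in> parcs D. z' e > 0}"
    let ?B = "{s \<in> pverts D - {n}. net_outflow D z s > 0}"
    let ?B' = "{s \<in> pverts D - {n}. net_outflow D z' s > 0}"
    have P: "?P' \<subseteq> ?P" using z'le by (auto intro: less_le_trans)
    have B: "?B' \<subseteq> ?B" using eps_pos s(3) by (auto simp: net of_bool_def split: if_splits)
    have fin: "finite ?P" "finite ?B" by auto
    \<comment> \<open>The minimum is attained either by the supply, and then \<open>s\<close> stops
      being a source, or by a ratio, and then that arc becomes empty.\<close>
    have "?P' \<subset> ?P \<or> ?B' \<subset> ?B"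
    proof (cases "\<epsilon> = net_outflow D z s")
      case True
      then have "s \<in> ?B" "s \<notin> ?B'" using s by (auto simp: net)
      then show ?thesis using B by blast
    next
      case False
      then obtain e where e: "e \<in> parcs D" "f e > 0" "\<epsilon> = z e / f e"
        using eps by (auto simp: Q_def)
      then have "z' e = 0" by (simp add: z'_def)
      then have "e \<notin> ?P'" "e \<in> ?P" using f(2)[OF e(2)] by auto
      then show ?thesis using P by blast
    qed
    then have "card ?P' < card ?P \<or> card ?B' < card ?B"
      using psubset_card_mono[OF fin(1)] psubset_card_mono[OF fin(2)] by blast
    then have "card ?P' + card ?B' < card ?P + card ?B"
      using card_mono[OF fin(1) P] card_mono[OF fin(2) B] by linarith
    from less.hyps[OF this z'0 b'] obtain y where
      y: "\<forall>s. \<forall>e\<in>parcs D. y s e \<ge> 0"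
        "\<forall>s\<in>pverts D - {n}. \<forall>i\<in>pverts D.
           net_outflow D (y s) i = net_outflow D z' s * (of_bool (i = s) - of_bool (i = n))"
        "\<forall>e\<in>parcs D. (\<Sum>s\<in>pverts D - {n}. y s e) \<le> z' e" by blast
    \<comment> \<open>The flow that was removed is credited to the piece of source
      \<open>s\<close>.\<close>
    define y' where "y' = (\<lambda>t e. y t e + (if t = s then \<epsilon> else 0) * f e)"
    have "y' t e \<ge> 0" if "e \<in> parcs D" for t e
      using y(1) that f(1)[of e] eps_pos by (simp add: y'_def)
    moreover have "net_outflow D (y' t) i = net_outflow D z t * (of_bool (i = t) - of_bool (i = n))"
      if "t \<in> pverts D - {n}" "i \<in> pverts D" for t i
    proof -
      have "net_outflow D (y t) i =
          (net_outflow D z t - \<epsilon> * of_bool (t = s)) * (of_bool (i = t) - of_bool (i = n))"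
        using y(2) that by (simp add: net)
      then show ?thesis
        unfolding y'_def net_outflow_add net_outflow_scale f(3)
        by (cases "t = s") (simp_all add: algebra_simps)
    qed
    moreover have "(\<Sum>t\<in>pverts D - {n}. y' t e) \<le> z e" if "e \<in> parcs D" for e
    proof -
      have "(\<Sum>t\<in>pverts D - {n}. (if t = s then \<epsilon> else 0) * f e) = \<epsilon> * f e"
        using s unfolding sum_distrib_right[symmetric] by (simp add: sum.delta)
      then show ?thesis
        using y(3) that by (simp add: y'_def sum.distrib z'_def algebra_simps)
    qed
    ultimately show ?thesis by blast
  qed
qed

section \<open>Structure of the extended graph\<close>

lemma dummy_edges_eq:
  assumes "pair_fin_digraph G" "n \<notin> pverts G"
  shows "dummy_edges G OD n = (\<lambda>i. (i, n)) ` {i \<in> pverts G. imbalance OD i < 0}"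
proof -
  interpret pair_fin_digraph G by fact
  have "(i, n) \<notin> parcs G" for i using in_arcsD2[of i n] assms(2) by auto
  then show ?thesis by (auto simp: dummy_edges_def ext_graph_def)
qed

lemma pair_fin_digraph_ext_graph:
  assumes "pair_fin_digraph G"
  shows "pair_fin_digraph (ext_graph G OD n)"
proof -
  interpret pair_fin_digraph G by fact
  have "{(i, n) | i. i \<in> pverts G \<and> imbalance OD i < 0} =
      (\<lambda>i. (i, n)) ` {i \<in> pverts G. imbalance OD i < 0}" by auto
  then have "finite {(i, n) | i. i \<in> pverts G \<and> imbalance OD i < 0}" by simp
  then show ?thesis
    using in_arcsD1 in_arcsD2 by unfold_locales (auto simp: ext_graph_def)
qed

text \<open>An old vertex can gain only the outgoing arc to \<open>n\<close>; nothing enters it from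
  \<open>n\<close>, which has no outgoing arcs.\<close>

lemma net_outflow_ext_graph:
  assumes "pair_fin_digraph G" "n \<notin> pverts G" "i \<in> pverts G"
  shows "net_outflow (ext_graph G OD n) x i =
    net_outflow G x i + (if imbalance OD i < 0 then x (i, n) else 0)"
proof -
  interpret pair_fin_digraph G by fact
  have notin: "(i, n) \<notin> parcs G" using in_arcsD2[of i n] assms(2) by auto
  have "{j. (i, j) \<in> parcs (ext_graph G OD n)} =
      (if imbalance OD i < 0 then insert n {j. (i, j) \<in> parcs G} else {j. (i, j) \<in> parcs G})"
    using assms(3) by (auto simp: ext_graph_def)
  moreover have "{j. (j, i) \<in> parcs (ext_graph G OD n)} = {j. (j, i) \<in> parcs G}"
    using assms(2,3) by (auto simp: ext_graph_def)
  ultimately show ?thesis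
    using notin finite_arcs_from_to[OF assms(1), of i] by (simp add: net_outflow_def)
qed

lemma net_outflow_ext_graph_dummy:
  assumes "pair_fin_digraph G" "n \<notin> pverts G"
  shows "net_outflow (ext_graph G OD n) x n = - (\<Sum>e\<in>dummy_edges G OD n. x e)"
proof -
  interpret pair_fin_digraph G by fact
  have notin: "(i, n) \<notin> parcs G" "(n, i) \<notin> parcs G" for i
    using in_arcsD2[of i n] in_arcsD1[of n i] assms(2) by auto
  have "{j. (n, j) \<in> parcs (ext_graph G OD n)} = {}"
    using assms(2) notin by (auto simp: ext_graph_def)
  moreover have "{j. (j, n) \<in> parcs (ext_graph G OD n)} = {i \<in> pverts G. imbalance OD i < 0}"
    using notin by (auto simp: ext_graph_def)
  ultimately show ?thesis
    unfolding net_outflow_def dummy_edges_eq[OF assms]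
    by (simp add: sum.reindex inj_on_def)
qed

section \<open>Total capacity and total flow of the dummy edges\<close>

text \<open>Each request adds its intensity at its destination and subtracts it at its
  origin.\<close>

lemma sum_imbalance:
  assumes "finite (pverts G)" "valid_requests (pverts G) OD"
  shows "(\<Sum>i\<in>pverts G. imbalance OD i) = 0"
proof -
  have "(\<Sum>i\<in>pverts G. imbalance OD i) =
    (\<Sum>m\<in>req_index OD. \<Sum>i\<in>pverts G.
        (of_bool (destination OD m = i) - of_bool (origin OD m = i)) * intensity OD m)"
    unfolding imbalance_def by (rule sum.swap)
  also have "\<dots> = 0"
  proof (rule sum.neutral, rule ballI)
    fix m assume "m \<in> req_index OD"
    then have "origin OD m \<in> pverts G" "destination OD m \<in> pverts G"
      using assms(2) by (auto simp: valid_requests_def)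
    then show "(\<Sum>i\<in>pverts G.
        (of_bool (destination OD m = i) - of_bool (origin OD m = i)) * intensity OD m) = 0"
      using assms(1) unfolding sum_distrib_right[symmetric] sum_subtractf
      by (simp add: of_bool_def sum.delta)
  qed
  finally show ?thesis .
qed

lemma total_rebalancing_eq_sum_pos:
  assumes "finite (pverts G)"
  shows "total_rebalancing G OD = (\<Sum>i | i \<in> pverts G \<and> imbalance OD i > 0. imbalance OD i)"
proof -
  have "(\<Sum>i | i \<in> pverts G \<and> imbalance OD i > 0. imbalance OD i) =
      (\<Sum>i\<in>pverts G. if imbalance OD i > 0 then imbalance OD i else 0)"
    by (rule sum.inter_filter) fact
  also have "\<dots> = total_rebalancing G OD"
    unfolding total_rebalancing_def by (intro sum.cong) auto
  finally show ?thesis by simp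
qed

text \<open>As the imbalances sum to zero, the negative ones have the same total size as the
  positive ones.\<close>

lemma sum_dummy_capacity:
  assumes "pair_fin_digraph G" "n \<notin> pverts G" "valid_requests (pverts G) OD"
  shows "(\<Sum>e\<in>dummy_edges G OD n. ext_capacity G OD \<kappa> e) = total_rebalancing G OD"
proof -
  interpret pair_fin_digraph G by fact
  let ?r = "imbalance OD"
  have notin: "(i, n) \<notin> parcs G" for i using in_arcsD2[of i n] assms(2) by auto
  have "(\<Sum>e\<in>dummy_edges G OD n. ext_capacity G OD \<kappa> e) =
      (\<Sum>i | i \<in> pverts G \<and> ?r i < 0. - ?r i)"
    unfolding dummy_edges_eq[OF assms(1,2)]
    by (simp add: sum.reindex inj_on_def ext_capacity_def notin)
  also have "\<dots> = (\<Sum>i\<in>pverts G. if ?r i < 0 then - ?r i else 0)"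
    by (rule sum.inter_filter) simp
  also have "\<dots> = (\<Sum>i\<in>pverts G. of_bool (?r i > 0) * ?r i - ?r i)"
    by (intro sum.cong) auto
  also have "\<dots> = total_rebalancing G OD"
    using sum_imbalance[OF pair_finite_verts assms(3)]
    by (simp add: sum_subtractf total_rebalancing_def)
  finally show ?thesis .
qed

lemma feasible_assignment_nonneg:
  assumes "feasible_assignment D OD x" "e \<in> parcs D"
  shows "x e \<ge> 0"
proof -
  obtain y where "\<forall>m\<in>req_index OD. \<forall>e\<in>parcs D. y m e \<ge> 0"
    "\<forall>e\<in>parcs D. x e = (\<Sum>m\<in>req_index OD. y m e)"
    using assms(1) unfolding feasible_assignment_def by blast
  then show ?thesis using assms(2) by (simp add: sum_nonneg)
qed

text \<open>All flow into \<open>n\<close> uses dummy edges and none leaves \<open>n\<close>, so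
  their total is the demand ending at \<open>n\<close>: the added requests, of total intensity
  \<open>R\<close>.\<close>

lemma sum_dummy_flow:
  assumes "pair_fin_digraph G" "n \<notin> pverts G" "valid_requests (pverts G) OD"
    and "feasible_assignment (ext_graph G OD n) (ext_requests G OD n) x"
  shows "(\<Sum>e\<in>dummy_edges G OD n. x e) = total_rebalancing G OD"
proof -
  interpret pair_fin_digraph G by fact
  let ?G = "ext_graph G OD n" and ?OD = "ext_requests G OD n"
  let ?S = "{i \<in> pverts G. imbalance OD i > 0}"
  obtain y where
    y: "\<forall>m\<in>req_index ?OD. \<forall>i\<in>pverts ?G. net_outflow ?G (y m) i = balance ?OD i m"
      "\<forall>e\<in>parcs ?G. x e = (\<Sum>m\<in>req_index ?OD. y m e)"
    using assms(4) unfolding feasible_assignment_def by blast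
  have idx: "req_index ?OD = req_index OD <+> ?S" by (simp add: ext_requests_def)
  have fin: "finite (req_index OD)" using assms(3) by (simp add: valid_requests_def)
  have nV: "n \<in> pverts ?G" by (simp add: ext_graph_def)
  have "(\<Sum>e\<in>dummy_edges G OD n. x e) =
      (\<Sum>e\<in>dummy_edges G OD n. \<Sum>m\<in>req_index ?OD. y m e)"
    using y(2) by (intro sum.cong) (auto simp: dummy_edges_def)
  also have "\<dots> = (\<Sum>m\<in>req_index ?OD. \<Sum>e\<in>dummy_edges G OD n. y m e)"
    by (rule sum.swap)
  also have "\<dots> = (\<Sum>m\<in>req_index ?OD. - balance ?OD n m)"
  proof (rule sum.cong[OF refl])
    fix m assume "m \<in> req_index ?OD"
    then have "net_outflow ?G (y m) n = balance ?OD n m" using y(1) nV by blast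
    then show "(\<Sum>e\<in>dummy_edges G OD n. y m e) = - balance ?OD n m"
      by (simp add: net_outflow_ext_graph_dummy[OF assms(1,2)])
  qed
  also have "\<dots> = (\<Sum>m\<in>req_index OD. - balance ?OD n (Inl m)) + (\<Sum>i\<in>?S. - balance ?OD n (Inr i))"
    unfolding idx using fin by (subst sum.Plus) auto
  also have "(\<Sum>m\<in>req_index OD. - balance ?OD n (Inl m)) = 0"
    using assms(2,3)
    by (intro sum.neutral) (auto simp: balance_def ext_requests_def valid_requests_def)
  also have "(\<Sum>i\<in>?S. - balance ?OD n (Inr i)) = (\<Sum>i\<in>?S. imbalance OD i)"
    using assms(2) by (intro sum.cong) (auto simp: balance_def ext_requests_def)
  finally show ?thesis by (simp add: total_rebalancing_eq_sum_pos)
qed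

section \<open>A feasible extended assignment respecting the dummy capacities\<close>

lemma ext_assignment_within_dummy_capacity:
  assumes "pair_fin_digraph G" "n \<notin> pverts G" "valid_requests (pverts G) OD"
    and "amod_feasible G OD"
  shows "\<exists>x. feasible_assignment (ext_graph G OD n) (ext_requests G OD n) x \<and>
    (\<forall>e\<in>dummy_edges G OD n. x e \<le> ext_capacity G OD \<kappa> e)"
proof -
  interpret pair_fin_digraph G by fact
  let ?G = "ext_graph G OD n" and ?OD = "ext_requests G OD n" and ?r = "imbalance OD"
  let ?S = "{i \<in> pverts G. ?r i > 0}"
  have D: "pair_fin_digraph ?G" by (rule pair_fin_digraph_ext_graph) fact
  have notin: "(i, n) \<notin> parcs G" for i using in_arcsD2[of i n] assms(2) by auto
  have idx: "req_index ?OD = req_index OD <+> ?S" by (simp add: ext_requests_def)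
  have fin: "finite (req_index OD)" using assms(3) by (simp add: valid_requests_def)
  have verts: "pverts ?G = insert n (pverts G)" by (simp add: ext_graph_def)
  have sources: "pverts ?G - {n} = pverts G" using assms(2) verts by auto
  \<comment> \<open>Flows are modified outside \<open>parcs G\<close> below; net outflow in
    \<open>G\<close> does not see this.\<close>
  have net_cong: "net_outflow G f i = net_outflow G g i" if "\<And>e. e \<in> parcs G \<Longrightarrow> f e = g e" for f g i
    unfolding net_outflow_def using that
    by (intro arg_cong2[where f = "(-)"] sum.cong) auto
  obtain y where y: "\<forall>m\<in>req_index OD. \<forall>e\<in>parcs G. y m e \<ge> (0::real)"
    "\<forall>m\<in>req_index OD. \<forall>i\<in>pverts G. net_outflow G (y m) i = balance OD i m"
    using assms(4) unfolding amod_feasible_def feasible_assignment_def by blast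
  obtain w where w: "\<forall>e\<in>parcs G. w e \<ge> 0" "\<forall>i\<in>pverts G. net_outflow G w i = ?r i"
    using assms(4) unfolding amod_feasible_def feasible_rebalancing_def by blast
  \<comment> \<open>Whatever rebalancing delivers to a deficit vertex is forwarded to
    \<open>n\<close>, filling each dummy edge exactly to capacity. Deficit vertices become balanced
    and surplus vertices are the only sources.\<close>
  define z where "z = (\<lambda>e. if e \<in> parcs G then w e else - ?r (fst e))"
  have z0: "\<forall>e\<in>parcs ?G. z e \<ge> 0"
    using w(1) by (auto simp: z_def ext_graph_def)
  have net_z: "net_outflow ?G z i = (if ?r i > 0 then ?r i else 0)" if "i \<in> pverts G" for i
  proof -
    have "net_outflow G z i = ?r i"
      using w(2) that net_cong[of z w] by (simp add: z_def)
    then show ?thesis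
      using net_outflow_ext_graph[OF assms(1,2) that, of OD z] by (simp add: z_def notin)
  qed
  have "\<forall>i\<in>pverts ?G - {n}. net_outflow ?G z i \<ge> 0"
    unfolding sources using net_z by simp
  moreover have "n \<in> pverts ?G" by (simp add: verts)
  ultimately have "\<exists>q. (\<forall>s. \<forall>e\<in>parcs ?G. q s e \<ge> 0) \<and>
      (\<forall>s\<in>pverts G. \<forall>i\<in>pverts ?G.
         net_outflow ?G (q s) i = net_outflow ?G z s * (of_bool (i = s) - of_bool (i = n))) \<and>
      (\<forall>e\<in>parcs ?G. (\<Sum>s\<in>pverts G. q s e) \<le> z e)"
    using flow_split_by_source[OF D _ z0, of n] unfolding sources by blast
  then obtain q where
    q: "\<forall>s. \<forall>e\<in>parcs ?G. q s e \<ge> 0"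
      "\<forall>s\<in>pverts G. \<forall>i\<in>pverts ?G.
         net_outflow ?G (q s) i = net_outflow ?G z s * (of_bool (i = s) - of_bool (i = n))"
      "\<forall>e\<in>parcs ?G. (\<Sum>s\<in>pverts G. q s e) \<le> z e"
    by blast
  \<comment> \<open>Original requests avoid the dummy edges; the added request of a surplus vertex
    uses the piece of \<open>z\<close> belonging to that source.\<close>
  define p where "p = case_sum (\<lambda>m e. if e \<in> parcs G then y m e else 0) q"
  define x where "x = (\<lambda>e. \<Sum>m\<in>req_index ?OD. p m e)"
  have "net_outflow ?G (p m) i = balance ?OD i m" if m: "m \<in> req_index ?OD" and i: "i \<in> pverts ?G" for m i
  proof (cases m)
    case (Inl k)
    then have k: "k \<in> req_index OD" using m idx by auto
    then have ends: "origin OD k \<noteq> n" "destination OD k \<noteq> n"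
      using assms(2,3) by (auto simp: valid_requests_def)
    show ?thesis
    proof (cases "i = n")
      case True
      then show ?thesis
        using Inl ends net_outflow_ext_graph_dummy[OF assms(1,2), of OD "p m"]
        by (auto simp: p_def balance_def ext_requests_def dummy_edges_def intro!: sum.neutral)
    next
      case False
      then have iV: "i \<in> pverts G" using i verts by simp
      have "net_outflow G (p m) i = net_outflow G (y k) i"
        by (rule net_cong) (simp add: p_def Inl)
      then show ?thesis
        using Inl k y(2) iV net_outflow_ext_graph[OF assms(1,2) iV, of OD "p m"]
        by (simp add: p_def notin balance_def ext_requests_def)
    qed
  next
    case (Inr s)
    then have s: "s \<in> pverts G" "?r s > 0" using m idx by auto
    then show ?thesis
      using Inr i q(2) net_z[OF s(1)] assms(2)
      by (auto simp: p_def balance_def ext_requests_def)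
  qed
  moreover have "p m e \<ge> 0" if "m \<in> req_index ?OD" "e \<in> parcs ?G" for m e
    using that y(1) q(1) idx by (cases m) (auto simp: p_def)
  ultimately have feas: "feasible_assignment ?G ?OD x"
    unfolding feasible_assignment_def x_def by blast
  have "x e \<le> ext_capacity G OD \<kappa> e" if e: "e \<in> dummy_edges G OD n" for e
  proof -
    have e': "e \<in> parcs ?G" "e \<notin> parcs G" using e by (auto simp: dummy_edges_def)
    have "x e = (\<Sum>m\<in>req_index OD. p (Inl m) e) + (\<Sum>s\<in>?S. p (Inr s) e)"
      unfolding x_def idx using fin by (subst sum.Plus) auto
    also have "\<dots> = (\<Sum>s\<in>?S. q s e)" using e' by (simp add: p_def)
    \<comment> \<open>The pieces of vertices without surplus are nonnegative, so they may be
      included.\<close>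
    also have "\<dots> \<le> (\<Sum>s\<in>pverts G. q s e)"
      using q(1) e'(1) by (intro sum_mono2) auto
    also have "\<dots> \<le> z e" using q(3) e'(1) by blast
    finally show ?thesis using e'(2) by (simp add: z_def ext_capacity_def)
  qed
  with feas show ?thesis by blast
qed

section \<open>Cost bounds for the original and dummy edges\<close>

text \<open>Isolates the dependence on \<open>L\<close> in the dummy edges.\<close>

lemma total_cost_ext_graph:
  assumes "pair_fin_digraph G"
  shows "total_cost (ext_time G L \<phi>) (ext_capacity G OD \<kappa>) (parcs (ext_graph G OD n)) x =
    total_cost \<phi> \<kappa> (parcs G) x +
    (\<Sum>e\<in>dummy_edges G OD n. x e * bpr_cost L (ext_capacity G OD \<kappa> e) (x e))"
proof -
  interpret pair_fin_digraph "ext_graph G OD n"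
    by (rule pair_fin_digraph_ext_graph) fact
  have sub: "parcs G \<subseteq> parcs (ext_graph G OD n)" by (auto simp: ext_graph_def)
  show ?thesis
    unfolding total_cost_def dummy_edges_def sum.subset_diff[OF sub pair_finite_arcs]
    by (simp add: ext_time_def ext_capacity_def)
qed

lemma bpr_total_le:
  assumes "\<kappa> > 0" "0 \<le> x" "x \<le> \<kappa>" "L > 0"
  shows "x * bpr_cost L \<kappa> x \<le> 1.15 * L * \<kappa>"
proof -
  have "(x / \<kappa>) ^ 4 \<le> 1" using assms by (intro power_le_one) auto
  then have "bpr_cost L \<kappa> x \<le> L * 1.15" unfolding bpr_cost_def using assms(4) by simp
  moreover have "0 \<le> bpr_cost L \<kappa> x" using assms(4) by (simp add: bpr_cost_def)
  ultimately have "x * bpr_cost L \<kappa> x \<le> \<kappa> * (L * 1.15)"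
    using assms by (intro mult_mono) auto
  then show ?thesis by (simp add: algebra_simps)
qed

text \<open>
  With \<open>u = x / \<kappa>\<close> the tangent of \<open>u ^ 5\<close> at \<open>1\<close> leaves a quadratic remainder, since
  \<open>u ^ 5 - 5 * u + 4 = (u - 1)\<^sup>2 * (u ^ 3 + 2 * u\<^sup>2 + 3 * u + 4)\<close>.  AM-GM turns the
  quadratic remainder into a linear one.
\<close>

lemma bpr_total_ge:
  assumes "\<kappa> > 0" "0 \<le> x" "L > 0" "\<delta> > 0"
  shows "x * bpr_cost L \<kappa> x \<ge>
    1.15 * L * \<kappa> + 1.75 * L * (x - \<kappa>) + 2.4 * L * \<delta> * (\<bar>x - \<kappa>\<bar> - \<delta> * \<kappa>)"
proof -
  define u where "u = x / \<kappa>"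
  have x: "x = \<kappa> * u" and u: "u \<ge> 0" using assms by (auto simp: u_def)
  have "u ^ 5 - 5 * u + 4 = (u - 1)\<^sup>2 * (u ^ 3 + 2 * u\<^sup>2 + 3 * u + 4)" by algebra
  \<comment> \<open>For \<open>u \<ge> 0\<close> the cubic factor is at least its constant term
    4.\<close>
  moreover have "(u - 1)\<^sup>2 * (u ^ 3 + 2 * u\<^sup>2 + 3 * u + 4) \<ge> (u - 1)\<^sup>2 * 4"
    using u by (intro mult_left_mono) auto
  ultimately have 1: "u ^ 5 \<ge> 1 + 5 * (u - 1) + 4 * (u - 1)\<^sup>2" by simp
  have "0 \<le> (\<bar>u - 1\<bar> - 2 * \<delta>)\<^sup>2" by simp
  then have 2: "(u - 1)\<^sup>2 \<ge> 4 * \<delta> * (\<bar>u - 1\<bar> - \<delta>)"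
    unfolding power2_diff power2_abs by (simp add: power2_eq_square algebra_simps)
  \<comment> \<open>Inserting the bound on \<open>u ^ 5\<close> into \<open>u + 0.15 * u ^ 5\<close>
    gives \<open>1.15 + 1.75 * (u - 1) + 0.6 * (u - 1)\<^sup>2\<close>; the factor 2.4 is 0.6 times
    4.\<close>
  have "1.15 + 1.75 * (u - 1) + 2.4 * \<delta> * (\<bar>u - 1\<bar> - \<delta>) =
      1.15 + 1.75 * (u - 1) + 0.6 * (4 * \<delta> * (\<bar>u - 1\<bar> - \<delta>))" by simp
  also have "\<dots> \<le> 1.15 + 1.75 * (u - 1) + 0.6 * (u - 1)\<^sup>2"
    using 2 by (intro add_left_mono mult_left_mono) simp_all
  also have "\<dots> \<le> u + 0.15 * u ^ 5"
    using 1 by (simp add: field_simps)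
  finally have "u + 0.15 * u ^ 5 \<ge> 1.15 + 1.75 * (u - 1) + 2.4 * \<delta> * (\<bar>u - 1\<bar> - \<delta>)" .
  then have "L * \<kappa> * (u + 0.15 * u ^ 5) \<ge>
      L * \<kappa> * (1.15 + 1.75 * (u - 1) + 2.4 * \<delta> * (\<bar>u - 1\<bar> - \<delta>))"
    using assms by (intro mult_left_mono) auto
  moreover have "x * bpr_cost L \<kappa> x = L * \<kappa> * (u + 0.15 * u ^ 5)"
    unfolding bpr_cost_def u_def[symmetric] x
    by (simp add: algebra_simps eval_nat_numeral)
  moreover have "\<bar>x - \<kappa>\<bar> = \<kappa> * \<bar>u - 1\<bar>"
  proof -
    have "x - \<kappa> = \<kappa> * (u - 1)" by (simp add: x algebra_simps)
    then show ?thesis using assms(1) by (simp add: abs_mult)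
  qed
  ultimately show ?thesis by (simp add: x algebra_simps)
qed

section \<open>Comparison of costs and choice of the threshold\<close>

theorem theorem1:
  fixes G :: "'v pair_pre_digraph"
    and \<kappa> \<phi> :: "'v \<times> 'v \<Rightarrow> real"
    and OD :: "('m, 'v) requests"
    and n :: 'v
  assumes "pair_fin_digraph G"
    and "\<forall>e\<in>parcs G. \<kappa> e > 0"
    and "\<forall>e\<in>parcs G. \<phi> e > 0"
    and "valid_requests (pverts G) OD"
    and "n \<notin> pverts G"
    and "total_rebalancing G OD > 0"
    and "amod_feasible G OD"
  shows "\<forall>\<delta>::real. 0 < \<delta> \<and> \<delta> \<le> 1 \<longrightarrow>
    (\<exists>L\<^sub>\<delta>::real. L\<^sub>\<delta> > 0 \<and>
      (\<forall>L > L\<^sub>\<delta>. \<forall>x.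
         is_arg_min
           (total_cost (ext_time G L \<phi>) (ext_capacity G OD \<kappa>) (parcs (ext_graph G OD n)))
           (feasible_assignment (ext_graph G OD n) (ext_requests G OD n)) x \<longrightarrow>
         (\<Sum>e\<in>dummy_edges G OD n. \<bar>x e - ext_capacity G OD \<kappa> e\<bar>)
           / (2 * total_rebalancing G OD) \<le> \<delta>))"
proof (intro allI impI)
  fix \<delta> :: real assume "0 < \<delta> \<and> \<delta> \<le> 1"
  then have \<delta>: "\<delta> > 0" by simp
  note G = assms(1) and n = assms(5) and OD = assms(4)
  let ?R = "total_rebalancing G OD" and ?\<kappa> = "ext_capacity G OD \<kappa>" and ?B = "dummy_edges G OD n"
  let ?feas = "feasible_assignment (ext_graph G OD n) (ext_requests G OD n)"
  let ?cost = "\<lambda>L. total_cost (ext_time G L \<phi>) ?\<kappa> (parcs (ext_graph G OD n))"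
  have R: "?R > 0" by fact
  obtain x0 where x0: "?feas x0" "\<forall>e\<in>?B. x0 e \<le> ?\<kappa> e"
    using ext_assignment_within_dummy_capacity[OF G n OD assms(7)] by blast
  \<comment> \<open>\<open>x0\<close> is fixed before \<open>L\<close>: feasibility and the cost on
    the original edges do not involve \<open>L\<close>.\<close>
  define C where "C = total_cost \<phi> \<kappa> (parcs G) x0"
  have flow_nonneg: "x e \<ge> 0" if "?feas x" "e \<in> parcs G \<union> ?B" for x e
    using feasible_assignment_nonneg[OF that(1), of e] that(2)
    by (auto simp: dummy_edges_def ext_graph_def)
  have \<kappa>_pos: "?\<kappa> e > 0" if "e \<in> ?B" for e
    using that by (auto simp: dummy_edges_eq[OF G n] dummy_edges_def[symmetric] ext_capacity_def
        assms(2)[rule_format])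
  have cost_nonneg: "total_cost \<phi> \<kappa> (parcs G) x \<ge> 0" if "?feas x" for x
    unfolding total_cost_def bpr_cost_def
    using flow_nonneg[OF that] assms(3)
    by (intro sum_nonneg mult_nonneg_nonneg) (auto simp: less_imp_le)
  \<comment> \<open>Chosen so that \<open>L > L0\<close> yields
    \<open>C \<le> 2.4 * L * \<delta>\<^sup>2 * ?R\<close>; the added 1 keeps \<open>L0\<close>
    positive when \<open>C = 0\<close>.\<close>
  define L0 where "L0 = C / (2.4 * \<delta>\<^sup>2 * ?R) + 1"
  have C: "C \<ge> 0" unfolding C_def by (rule cost_nonneg[OF x0(1)])
  have "L0 > 0" using C R by (simp add: L0_def add_nonneg_pos)
  moreover have "(\<Sum>e\<in>?B. \<bar>x e - ?\<kappa> e\<bar>) / (2 * ?R) \<le> \<delta>"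
    if L: "L > L0" and x: "is_arg_min (?cost L) ?feas x" for L x
  proof -
    let ?N = "\<Sum>e\<in>?B. \<bar>x e - ?\<kappa> e\<bar>"
    have L_pos: "L > 0" using L \<open>L0 > 0\<close> by simp
    have fx: "?feas x" and min: "?cost L x \<le> ?cost L x0"
      using x x0(1) by (auto simp: is_arg_min_def not_less)
    have sum_\<kappa>: "(\<Sum>e\<in>?B. ?\<kappa> e) = ?R" by (rule sum_dummy_capacity[OF G n OD])
    have sum_x: "(\<Sum>e\<in>?B. x e) = ?R" by (rule sum_dummy_flow[OF G n OD fx])
    have "(\<Sum>e\<in>?B. x0 e * bpr_cost L (?\<kappa> e) (x0 e)) \<le> (\<Sum>e\<in>?B. 1.15 * L * ?\<kappa> e)"
      using x0 flow_nonneg \<kappa>_pos L_pos by (intro sum_mono bpr_total_le) auto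
    also have "\<dots> = 1.15 * L * ?R" by (simp only: sum_distrib_left[symmetric] sum_\<kappa>)
    finally have upper: "?cost L x0 \<le> C + 1.15 * L * ?R"
      by (simp add: total_cost_ext_graph[OF G] C_def)
    \<comment> \<open>The linear terms cancel in the sum because dummy flows and dummy capacities
      have the same total.\<close>
    have "1.15 * L * ?R + 2.4 * L * \<delta> * (?N - \<delta> * ?R) =
        (\<Sum>e\<in>?B. 1.15 * L * ?\<kappa> e + 1.75 * L * (x e - ?\<kappa> e) +
           2.4 * L * \<delta> * (\<bar>x e - ?\<kappa> e\<bar> - \<delta> * ?\<kappa> e))"
      by (simp only: sum.distrib sum_subtractf sum_distrib_left[symmetric] sum_\<kappa> sum_x) simp
    also have "\<dots> \<le> (\<Sum>e\<in>?B. x e * bpr_cost L (?\<kappa> e) (x e))"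
      using fx flow_nonneg \<kappa>_pos L_pos \<delta> by (intro sum_mono bpr_total_ge) auto
    also have "\<dots> \<le> ?cost L x"
      using cost_nonneg[OF fx] by (simp add: total_cost_ext_graph[OF G])
    finally have "2.4 * L * \<delta> * (?N - \<delta> * ?R) \<le> C" using min upper by linarith
    also have "C \<le> 2.4 * L * \<delta> * (\<delta> * ?R)"
    proof -
      have "C / (2.4 * \<delta>\<^sup>2 * ?R) \<le> L" using L by (simp add: L0_def)
      moreover have "2.4 * \<delta>\<^sup>2 * ?R > 0" using \<delta> R by simp
      ultimately have "C \<le> L * (2.4 * \<delta>\<^sup>2 * ?R)" by (simp only: pos_divide_le_eq)
      then show ?thesis by (simp add: power2_eq_square algebra_simps)
    qed
    \<comment> \<open>Cancelling \<open>2.4 * L * \<delta>\<close> leaves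
      \<open>?N \<le> 2 * \<delta> * ?R\<close>: one share of \<open>\<delta> * ?R\<close> comes
      from AM-GM, the other from the size of \<open>L\<close>.\<close>
    finally have "?N - \<delta> * ?R \<le> \<delta> * ?R"
      by (rule mult_left_le_imp_le) (use L_pos \<delta> in simp)
    then show ?thesis using R by (simp add: field_simps)
  qed
  ultimately show "\<exists>L\<^sub>\<delta>::real. L\<^sub>\<delta> > 0 \<and>
      (\<forall>L > L\<^sub>\<delta>. \<forall>x. is_arg_min (?cost L) ?feas x \<longrightarrow>
         (\<Sum>e\<in>?B. \<bar>x e - ?\<kappa> e\<bar>) / (2 * ?R) \<le> \<delta>)"
    by blast
qed

end
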